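(* Let $P$ be the standard parabolic subgroup of $\mathrm{GL}(n,\mathbb{F}_q)$ of type $(n_1,\dots,n_s)$. Then any element of $J$ is equivalent to some element of $J$ associated with a block-rook placement.
   Context: $\mathbb{F}_q$ is a finite field, $n=n_1+\dots+n_s$, and $\{1,\dots,n\}$ is divided into consecutive segments $I_1,\dots,I_s$ of sizes $n_1,\dots,n_s$. The standard parabolic subgroup of type $(n_1,\dots,n_s)$ is the group $P$ of invertible block upper triangular matrices with diagonal blocks of sizes $n_1,\dots,n_s$. $P=RN$, where $R=\mathrm{GL}(n_1,\mathbb{F}_q)\times\dots\times \mathrm{GL}(n_s,\mathbb{F}_q)$ is the block-diagonal subgroup and $N=1+J$, with $J$ the algebra of strictly block upper triangular matrices. Put $\Delta_J=\bigcup_{1\le k<\ell\le s} I_k\times I_\ell$; the matrix units $\{E_\alpha:\alpha\in\Delta_J\}$ form a basis of $J$. Elements $x,x'\in J$ are equivalent if there exist $r\in R$ and $a,b\in N$ such that $x'=raxbr^{-1}$. A block-rook is a subset $A_k\times A_\ell\subseteq I_k\times I_\ell$ with $k<\ell$, $A_k\subseteq I_k$, $A_\ell\subseteq I_\ell$ and $|A_k|=|A_\ell|$. A subset $\mathbb{D}\subseteq\Delta_J$ is a block-rook placement if it is a (possibly empty) union of block-rooks which do not attack each other, i.e. each row and each column intersects at most one of the block-rooks. An element $x_{\mathbb{D}}\in J$ is associated with the block-rook placement $\mathbb{D}$ if $x_{\mathbb{D}}=\sum_{(i,j)\in\mathbb{D}}x_{ij}E_{ij}$ and for each block-rook $A_k\times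 A_\ell\subset\mathbb{D}$ of the placement the square submatrix $(x_{ij})_{i\in A_k,\,j\in A_\ell}$ is non-degenerate. *)

theory Defs
  imports "Jordan_Normal_Form.Determinant" "Jordan_Normal_Form.DL_Submatrix"
begin

text \<open>
  A type \<open>(n\<^sub>1, \<dots>, n\<^sub>s)\<close> is the list \<open>ns\<close> of block sizes, with \<open>s = length ns\<close> and
  \<open>n = sum_list ns\<close>. As matrix indices start at \<open>0\<close>, both the blocks and the
  rows and columns are numbered from \<open>0\<close>: the segments partition \<open>{0..<n}\<close>.
\<close>

definition segment :: "nat list \<Rightarrow> nat \<Rightarrow> nat set" where
  "segment ns k = {sum_list (take k ns) ..< sum_list (take (Suc k) ns)}"

definition Delta_J :: "nat list \<Rightarrow> (nat \<times> nat) set" where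
  "Delta_J ns = (\<Union>{segment ns k \<times> segment ns l | k l. k < l \<and> l < length ns})"

definition nil_algebra :: "nat list \<Rightarrow> 'a::field mat set" where
  "nil_algebra ns = {x \<in> carrier_mat (sum_list ns) (sum_list ns).
     \<forall>i < sum_list ns. \<forall>j < sum_list ns. (i, j) \<notin> Delta_J ns \<longrightarrow> x $$ (i, j) = 0}"

definition unipotent_radical :: "nat list \<Rightarrow> 'a::field mat set" where
  "unipotent_radical ns = {1\<^sub>m (sum_list ns) + x | x. x \<in> nil_algebra ns}"

definition parabolic :: "nat list \<Rightarrow> 'a::field mat set" where
  "parabolic ns = {g \<in> carrier_mat (sum_list ns) (sum_list ns). invertible_mat g \<and>
     (\<forall>k < length ns. \<forall>l < k. \<forall>i \<in> segment ns k. \<forall>j \<in> segment ns l. g $$ (i, j) = 0)}"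

text \<open>
  An invertible block-diagonal matrix has invertible diagonal blocks, so this is the
  subgroup \<open>GL(n\<^sub>1) \<times> \<dots> \<times> GL(n\<^sub>s)\<close>.
\<close>

definition levi_subgroup :: "nat list \<Rightarrow> 'a::field mat set" where
  "levi_subgroup ns = {g \<in> parabolic ns.
     \<forall>k < length ns. \<forall>l < length ns. k \<noteq> l \<longrightarrow>
       (\<forall>i \<in> segment ns k. \<forall>j \<in> segment ns l. g $$ (i, j) = 0)}"

text \<open>Below, \<open>r'\<close> is the inverse of \<open>r\<close>.\<close>

definition equivalent :: "nat list \<Rightarrow> 'a::field mat \<Rightarrow> 'a mat \<Rightarrow> bool" where
  "equivalent ns x x' \<longleftrightarrow>
     (\<exists>r \<in> levi_subgroup ns. \<exists>r' \<in> carrier_mat (sum_list ns) (sum_list ns).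
      \<exists>a \<in> unipotent_radical ns. \<exists>b \<in> unipotent_radical ns.
        inverts_mat r r' \<and> inverts_mat r' r \<and> x' = r * a * x * b * r')"

text \<open>
  A block-rook \<open>A \<times> B\<close> is represented by the pair \<open>(A, B)\<close>. Since \<open>card A = card B\<close>
  and both are finite, row \<open>i\<close> intersects \<open>A \<times> B\<close> iff \<open>i \<in> A\<close>, and column \<open>j\<close> does
  iff \<open>j \<in> B\<close>.
\<close>

definition block_rook :: "nat list \<Rightarrow> nat set \<times> nat set \<Rightarrow> bool" where
  "block_rook ns Q \<longleftrightarrow> (\<exists>k l. k < l \<and> l < length ns \<and>
     fst Q \<subseteq> segment ns k \<and> snd Q \<subseteq> segment ns l \<and> card (fst Q) = card (snd Q))"

definition non_attacking :: "(nat set \<times> nat set) set \<Rightarrow> bool" where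
  "non_attacking \<Q> \<longleftrightarrow>
     (\<forall>i. \<exists>\<^sub>\<le>\<^sub>1 Q. Q \<in> \<Q> \<and> i \<in> fst Q) \<and> (\<forall>j. \<exists>\<^sub>\<le>\<^sub>1 Q. Q \<in> \<Q> \<and> j \<in> snd Q)"

definition block_rooks_of ::
  "nat list \<Rightarrow> (nat \<times> nat) set \<Rightarrow> (nat set \<times> nat set) set \<Rightarrow> bool" where
  "block_rooks_of ns D \<Q> \<longleftrightarrow>
     (\<forall>Q \<in> \<Q>. block_rook ns Q) \<and> non_attacking \<Q> \<and> D = (\<Union>(A, B) \<in> \<Q>. A \<times> B)"

definition block_rook_placement :: "nat list \<Rightarrow> (nat \<times> nat) set \<Rightarrow> bool" where
  "block_rook_placement ns D \<longleftrightarrow> D \<subseteq> Delta_J ns \<and> (\<exists>\<Q>. block_rooks_of ns D \<Q>)"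

text \<open>
  The nonempty block-rooks of a placement \<open>D\<close> are determined by \<open>D\<close> (non-attacking ones
  share no rows or columns), so the choice of \<open>\<Q>\<close> below is immaterial.
\<close>

definition associated :: "nat list \<Rightarrow> (nat \<times> nat) set \<Rightarrow> 'a::field mat \<Rightarrow> bool" where
  "associated ns D x \<longleftrightarrow> x \<in> nil_algebra ns \<and>
     (\<forall>i < sum_list ns. \<forall>j < sum_list ns. (i, j) \<notin> D \<longrightarrow> x $$ (i, j) = 0) \<and>
     (\<exists>\<Q>. block_rooks_of ns D \<Q> \<and> (\<forall>(A, B) \<in> \<Q>. det (submatrix x A B) \<noteq> 0))"

end

(*
  Every x in J can be reduced to a matrix with at most one nonzero entry in each row and
  column, so that all block-rooks have size 1.  Work upwards through the row blocks, and let
  the rows below block k be reduced already.  Row operations clear, in block k, the columns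
  that contain one of the lower pivots.  Among the remaining columns, adding column b to
  column j may have to be accompanied, when b and j lie in the same block, by subtracting
  row j from row b, which spoils row b.  If row b has its pivot in column u and row j in
  column v, the damage at (b, v) is repaired by a multiple of column u, which in turn may
  spoil row u, and so on along the chain b, u, ...  The repair is possible when the sequence
  of blocks visited by the chain of b is lexicographically at most the one of j, so pivots of
  block k are taken in columns of least such rank.
*)
theory Submission
  imports Defs "Jordan_Normal_Form.Column_Operations" "HOL-Library.List_Lexorder"
begin

section \<open>Elementary moves on block strictly upper triangular matrices\<close>

locale block_structure =
  fixes n s :: nat and blk :: "nat \<Rightarrow> nat"
  assumes blk_less: "i < n \<Longrightarrow> blk i < s"
begin

definition upper :: "'a::field mat set" where
  "upper = {x \<in> carrier_mat n n. \<forall>i<n. \<forall>j<n. x $$ (i, j) \<noteq> 0 \<longrightarrow> blk i < blk j}"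

text \<open>With \<open>E\<close> the matrix unit at \<open>(i, j)\<close>, \<open>row\<close> and
  \<open>col\<close> multiply from the left and from the right by \<open>1 + c E\<close> in
  \<open>N\<close>, while \<open>conj\<close> sends \<open>x\<close> to
  \<open>(1 - c E) x (1 + c E)\<close> with \<open>1 + c E\<close> in \<open>R\<close>. So within a
  block a column addition drags along the opposite row operation.\<close>

inductive step :: "'a::field mat \<Rightarrow> 'a mat \<Rightarrow> bool" where
  row: "i < n \<Longrightarrow> j < n \<Longrightarrow> blk i < blk j \<Longrightarrow> step x (addrow c i j x)"
| col: "i < n \<Longrightarrow> j < n \<Longrightarrow> blk i < blk j \<Longrightarrow> step x (addcol c j i x)"
| conj: "i < n \<Longrightarrow> j < n \<Longrightarrow> i \<noteq> j \<Longrightarrow> blk i = blk j \<Longrightarrow>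
    step x (addrow (- c) i j (addcol c j i x))"

lemma upper_carrier: "x \<in> upper \<Longrightarrow> x \<in> carrier_mat n n"
  by (simp add: upper_def)

lemma upper_zero: "x \<in> upper \<Longrightarrow> i < n \<Longrightarrow> j < n \<Longrightarrow> blk j \<le> blk i \<Longrightarrow> x $$ (i, j) = 0"
  unfolding upper_def mem_Collect_eq not_less[symmetric] by blast

lemma index_addrow:
  fixes x :: "'a::field mat"
  shows "x \<in> carrier_mat n n \<Longrightarrow> r < n \<Longrightarrow> t < n \<Longrightarrow>
    addrow c i j x $$ (r, t) = x $$ (r, t) + (if r = i then c * x $$ (j, t) else 0)"
  by (cases "i = r") (simp_all add: add.commute)

lemma addcol_carrier: "(addcol c j i x \<in> carrier_mat n n) = (x \<in> carrier_mat n n)"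
  unfolding carrier_mat_def mem_Collect_eq index_mat_addcol(4,5) ..

lemma index_addcol:
  fixes x :: "'a::field mat"
  shows "x \<in> carrier_mat n n \<Longrightarrow> r < n \<Longrightarrow> t < n \<Longrightarrow>
    addcol c j i x $$ (r, t) = x $$ (r, t) + (if t = j then c * x $$ (r, i) else 0)"
  by (cases "j = t") (simp_all add: add.commute)

text \<open>The added row \<open>j\<close> is supported on blocks beyond \<open>blk j\<close>, hence
  beyond \<open>blk i\<close>. Equal blocks are allowed so that \<open>conj\<close> moves are
  covered too.\<close>

lemma addrow_upper:
  assumes "x \<in> upper" "i < n" "j < n" "blk i \<le> blk j"
  shows "addrow c i j x \<in> upper"
proof -
  have x: "x \<in> carrier_mat n n" by (rule upper_carrier[OF assms(1)])
  have "blk r < blk t" if "r < n" "t < n" "addrow c i j x $$ (r, t) \<noteq> 0" for r t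
  proof (rule ccontr)
    assume *: "\<not> blk r < blk t"
    then have "x $$ (r, t) = 0" "r = i \<Longrightarrow> x $$ (j, t) = 0"
      using upper_zero[OF assms(1) that(1,2)] upper_zero[OF assms(1,3) that(2)] assms(4) by simp_all
    then show False using that(3) unfolding index_addrow[OF x that(1,2)] by (cases "r = i") simp_all
  qed
  then show ?thesis using x by (auto simp: upper_def addcol_carrier)
qed

lemma addcol_upper:
  assumes "x \<in> upper" "i < n" "j < n" "blk i \<le> blk j"
  shows "addcol c j i x \<in> upper"
proof -
  have x: "x \<in> carrier_mat n n" by (rule upper_carrier[OF assms(1)])
  have "blk r < blk t" if "r < n" "t < n" "addcol c j i x $$ (r, t) \<noteq> 0" for r t
  proof (rule ccontr)
    assume *: "\<not> blk r < blk t"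
    then have "x $$ (r, t) = 0" "t = j \<Longrightarrow> x $$ (r, i) = 0"
      using upper_zero[OF assms(1) that(1,2)] upper_zero[OF assms(1) that(1) assms(2)] assms(4) by simp_all
    then show False using that(3) unfolding index_addcol[OF x that(1,2)] by (cases "t = j") simp_all
  qed
  then show ?thesis using x by (auto simp: upper_def addcol_carrier)
qed

lemma step_upper: "step x y \<Longrightarrow> x \<in> upper \<Longrightarrow> y \<in> upper"
  by (induction rule: step.induct) (simp_all add: addrow_upper addcol_upper)

lemma steps_upper: "step\<^sup>*\<^sup>* x y \<Longrightarrow> x \<in> upper \<Longrightarrow> y \<in> upper"
  by (induction rule: rtranclp_induct) (auto intro: step_upper)

section \<open>Rook form, ranks of chains and the repair of rows\<close>

text \<open>Rows in blocks before \<open>k\<close> are ignored even when columns are compared: they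
  are treated later, as \<open>k\<close> descends from \<open>s\<close> to \<open>0\<close>.\<close>

definition rook_from :: "nat \<Rightarrow> 'a::field mat \<Rightarrow> bool" where
  "rook_from k x \<longleftrightarrow>
     (\<forall>i<n. \<forall>j<n. \<forall>j'<n. k \<le> blk i \<longrightarrow> x $$ (i, j) \<noteq> 0 \<longrightarrow> x $$ (i, j') \<noteq> 0 \<longrightarrow> j = j') \<and>
     (\<forall>i<n. \<forall>i'<n. \<forall>j<n. k \<le> blk i \<longrightarrow> k \<le> blk i' \<longrightarrow>
        x $$ (i, j) \<noteq> 0 \<longrightarrow> x $$ (i', j) \<noteq> 0 \<longrightarrow> i = i')"

text \<open>In block \<open>k\<close> these columns can be cleared by subtracting lower rows. Once
  they vanish there, adding multiples of them to other columns leaves block \<open>k\<close>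
  unchanged, which makes repairs harmless.\<close>

definition hit_cols :: "nat \<Rightarrow> 'a::field mat \<Rightarrow> nat set" where
  "hit_cols k x = {t. t < n \<and> (\<exists>i<n. k < blk i \<and> x $$ (i, t) \<noteq> 0)}"

text \<open>
  The blocks met along \<open>i, j, \<dots>\<close>, where \<open>j\<close> is the column of the pivot of row \<open>i\<close>. A chain that
  ends is followed by \<open>s\<close>, which exceeds every block: a zero row has to come last, as it is
  harmless to subtract but has no pivot to repair with.
\<close>

primrec rank :: "'a::field mat \<Rightarrow> nat \<Rightarrow> nat \<Rightarrow> nat list" where
  "rank x 0 i = [blk i]"
| "rank x (Suc m) i = blk i #
     (if \<exists>j<n. x $$ (i, j) \<noteq> 0 then rank x m (SOME j. j < n \<and> x $$ (i, j) \<noteq> 0) else [s])"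

lemma rank_hd: "\<exists>l. rank x m i = blk i # l"
  by (cases m) auto

lemma rank_Suc_nonzero:
  assumes "rook_from k x" "i < n" "k \<le> blk i" "j < n" "x $$ (i, j) \<noteq> 0"
  shows "rank x (Suc m) i = blk i # rank x m j"
proof -
  have "(SOME j. j < n \<and> x $$ (i, j) \<noteq> 0) = j"
    by (rule some_equality) (use assms in \<open>auto simp: rook_from_def\<close>)
  then show ?thesis using assms by auto
qed

text \<open>Both chains start in the same block, so the lexicographic comparison passes to their
  next entries \<open>u\<close> and \<open>v\<close>.\<close>

lemma rank_less_Suc:
  assumes "rook_from k x" "i < n" "j < n" "k \<le> blk i" "blk i = blk j"
    "rank x (Suc m) i \<le> rank x (Suc m) j" "v < n" "x $$ (j, v) \<noteq> 0"
  obtains u where "u < n" "x $$ (i, u) \<noteq> 0" "blk u \<le> blk v"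
    "blk u = blk v \<Longrightarrow> rank x m u \<le> rank x m v"
proof -
  have j: "rank x (Suc m) j = blk j # rank x m v"
    by (rule rank_Suc_nonzero[OF assms(1,3)]) (use assms in auto)
  obtain lv where lv: "rank x m v = blk v # lv" using rank_hd by blast
  \<comment> \<open>If row \<open>i\<close> had no pivot, its rank would continue with
    \<open>s\<close>, which exceeds \<open>blk v\<close> and contradicts the comparison.\<close>
  have "blk v < s" by (rule blk_less[OF assms(7)])
  then obtain u where u: "u < n" "x $$ (i, u) \<noteq> 0"
    using assms(5,6) unfolding j by (auto simp: lv split: if_splits)
  have i: "rank x (Suc m) i = blk i # rank x m u"
    by (rule rank_Suc_nonzero[OF assms(1,2)]) (use assms u in auto)
  have *: "rank x m u \<le> rank x m v" using assms(5,6) unfolding i j by simp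
  obtain lu where lu: "rank x m u = blk u # lu" using rank_hd by blast
  from * have "blk u \<le> blk v" unfolding lu lv by auto
  with u * show ?thesis by (intro that) auto
qed

text \<open>
  \<open>x0\<close> is the intended state of the rows below block \<open>k\<close>, from which \<open>x\<close> differs by a multiple of
  row \<open>j\<close> in row \<open>i\<close>. As blocks strictly increase along a chain, \<open>s - blk i\<close> bounds the number
  \<open>m\<close> of repairs.
\<close>

lemma repair_row:
  fixes x x0 :: "'a::field mat"
  assumes "x0 \<in> upper" "rook_from (Suc k) x0"
  shows "x \<in> upper \<Longrightarrow> i < n \<Longrightarrow> j < n \<Longrightarrow> i \<noteq> j \<Longrightarrow> blk i = blk j \<Longrightarrow> k < blk i \<Longrightarrow>
    s \<le> blk i + m \<Longrightarrow> rank x0 m i \<le> rank x0 m j \<Longrightarrow>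
    (\<And>r t. r < n \<Longrightarrow> t < n \<Longrightarrow> k < blk r \<Longrightarrow>
      x $$ (r, t) = x0 $$ (r, t) + (if r = i then d * x0 $$ (j, t) else 0)) \<Longrightarrow>
    (\<And>r t. r < n \<Longrightarrow> blk r = k \<Longrightarrow> t \<in> hit_cols k x0 \<Longrightarrow> x $$ (r, t) = 0) \<Longrightarrow>
    \<exists>x'. step\<^sup>*\<^sup>* x x' \<and>
      (\<forall>r<n. \<forall>t<n. k < blk r \<longrightarrow> x' $$ (r, t) = x0 $$ (r, t)) \<and>
      (\<forall>r<n. \<forall>t<n. blk r = k \<longrightarrow> x' $$ (r, t) = x $$ (r, t))"
proof (induction m arbitrary: i j x d)
  case 0
  \<comment> \<open>No row has \<open>s <= blk i\<close>, so the budget of repairs never runs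
    out.\<close>
  then show ?case using blk_less[of i] by simp
next
  case (Suc m)
  note x = Suc.prems(1) and ij = Suc.prems(2-6) and rows = Suc.prems(9) and hit = Suc.prems(10)
  have xc: "x \<in> carrier_mat n n" by (rule upper_carrier[OF x])
  have unq_row: "t = t'" if "r < n" "k < blk r" "t < n" "t' < n" "x0 $$ (r, t) \<noteq> 0" "x0 $$ (r, t') \<noteq> 0" for r t t'
    using assms(2) that unfolding rook_from_def by (metis Suc_leI)
  have unq_col: "r = r'" if "r < n" "k < blk r" "r' < n" "k < blk r'" "t < n" "x0 $$ (r, t) \<noteq> 0" "x0 $$ (r', t) \<noteq> 0" for r r' t
    using assms(2) that unfolding rook_from_def by (metis Suc_leI)
  show ?case
  proof (cases "\<exists>v<n. x0 $$ (j, v) \<noteq> 0")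
    case False
    \<comment> \<open>Row \<open>j\<close> of \<open>x0\<close> vanishes, so \<open>x\<close>
      already agrees with \<open>x0\<close> below block \<open>k\<close>.\<close>
    then show ?thesis using rows by (intro exI[of _ x]) auto
  next
    case True
    then obtain v where v: "v < n" "x0 $$ (j, v) \<noteq> 0" by blast
    obtain u where u: "u < n" "x0 $$ (i, u) \<noteq> 0" and uv: "blk u \<le> blk v"
      and rk: "blk u = blk v \<Longrightarrow> rank x0 m u \<le> rank x0 m v"
      using rank_less_Suc[OF assms(2) ij(1,2) _ ij(4) Suc.prems(8) v] ij(5) by (metis Suc_leI)
    have iu: "blk i < blk u" using assms(1) ij u by (auto simp: upper_def)
    have "u \<noteq> v" using unq_col[of i j u] u v ij by auto
    have hits: "u \<in> hit_cols k x0" "v \<in> hit_cols k x0"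
      using u v ij by (auto simp: hit_cols_def)
    \<comment> \<open>Solves \<open>d * x0 $$ (j, v) + e * x0 $$ (i, u) = 0\<close>: adding
      \<open>e\<close> times column \<open>u\<close> to column \<open>v\<close> cancels the damage
      at \<open>(i, v)\<close>.\<close>
    define e where "e = - d * x0 $$ (j, v) / x0 $$ (i, u)"
    have x0j: "x0 $$ (j, t) = (if t = v then x0 $$ (j, v) else 0)" if "t < n" for t
      using unq_row[OF ij(2) _ that v(1) _ v(2)] ij(4,5) by (cases "t = v") auto
    have x0iv: "x0 $$ (i, v) = 0"
      using unq_col[OF ij(1) ij(5) ij(2) _ v(1) _ v(2)] ij(3-5) by metis
    have x0u: "x0 $$ (r, u) = (if r = i then x0 $$ (i, u) else 0)" if "r < n" "k < blk r" for r
      using unq_col[OF that ij(1) ij(5) u(1) _ u(2)] by (cases "r = i") auto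
    \<comment> \<open>Below block \<open>k\<close>, column \<open>u\<close> is nonzero in row
      \<open>i\<close> only, so the column addition changes just the entry \<open>(i, v)\<close>
      there.\<close>
    have xu: "x $$ (r, u) = (if r = i then x0 $$ (i, u) else 0)" if "r < n" "k < blk r" for r
      using rows[OF that(1) u(1) that(2)] x0u[OF that] x0j[OF u(1)] \<open>u \<noteq> v\<close> by auto
    define y where "y = addcol e v u x"
    have yrows: "y $$ (r, t) = x0 $$ (r, t)" if "r < n" "t < n" "k < blk r" for r t
      unfolding y_def index_addcol[OF xc that(1,2)] rows[OF that] xu[OF that(1,3)]
      using x0j[OF that(2)] x0iv u by (auto simp: e_def)
    have yT: "y $$ (r, t) = x $$ (r, t)" if "r < n" "t < n" "blk r = k" for r t
      unfolding y_def index_addcol[OF xc that(1,2)]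
      using hit[OF that(1,3) hits(1)] by simp
    show ?thesis
    proof (cases "blk u = blk v")
      case False
      have "step x y" unfolding y_def by (rule step.col) (use u v uv False in auto)
      then show ?thesis using yrows yT by (intro exI[of _ y]) auto
    next
      case True
      \<comment> \<open>Inside one block the column addition comes with subtracting \<open>e\<close>
        times row \<open>v\<close> from row \<open>u\<close>. This is the original situation one
        place further along both chains, with \<open>u\<close>, \<open>v\<close>, \<open>- e\<close>
        for \<open>i\<close>, \<open>j\<close>, \<open>d\<close>.\<close>
      define z where "z = addrow (- e) u v y"
      have st: "step x z" unfolding z_def y_def
        by (rule step.conj) (use u v True \<open>u \<noteq> v\<close> in auto)
      have yc: "y \<in> carrier_mat n n" using xc unfolding y_def by (simp add: addcol_carrier)
      have zrows: "z $$ (r, t) = x0 $$ (r, t) + (if r = u then - e * x0 $$ (v, t) else 0)"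
        if "r < n" "t < n" "k < blk r" for r t
        unfolding z_def index_addrow[OF yc that(1,2)] yrows[OF that]
        using yrows[OF v(1) that(2)] iu ij True by auto
      have zT: "z $$ (r, t) = x $$ (r, t)" if "r < n" "t < n" "blk r = k" for r t
        unfolding z_def index_addrow[OF yc that(1,2)] yT[OF that]
        using iu ij that by auto
      have "\<exists>x'. step\<^sup>*\<^sup>* z x' \<and>
        (\<forall>r<n. \<forall>t<n. k < blk r \<longrightarrow> x' $$ (r, t) = x0 $$ (r, t)) \<and>
        (\<forall>r<n. \<forall>t<n. blk r = k \<longrightarrow> x' $$ (r, t) = z $$ (r, t))"
      proof (rule Suc.IH[of z u v "- e"])
        show "z \<in> upper" by (rule step_upper[OF st x])
        show "s \<le> blk u + m" using Suc.prems(7) iu by simp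
        show "z $$ (r, t) = 0" if "r < n" "blk r = k" "t \<in> hit_cols k x0" for r t
          using hit[OF that] zT[OF that(1) _ that(2)] that(3) by (auto simp: hit_cols_def)
        show "k < blk u" using iu ij(5) by simp
      qed (use u v True rk \<open>u \<noteq> v\<close> in \<open>simp_all add: zrows\<close>)
      then obtain x' where x': "step\<^sup>*\<^sup>* z x'"
        "\<forall>r<n. \<forall>t<n. k < blk r \<longrightarrow> x' $$ (r, t) = x0 $$ (r, t)"
        "\<forall>r<n. \<forall>t<n. blk r = k \<longrightarrow> x' $$ (r, t) = z $$ (r, t)" by blast
      show ?thesis
        using x'(2,3) zT converse_rtranclp_into_rtranclp[of step, OF st x'(1)] by (intro exI[of _ x']) simp
    qed
  qed
qed

section \<open>Row and column additions seen from one row block\<close>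

definition agree_below :: "nat \<Rightarrow> 'a::field mat \<Rightarrow> 'a mat \<Rightarrow> bool" where
  "agree_below k x y \<longleftrightarrow> (\<forall>r<n. \<forall>t<n. k < blk r \<longrightarrow> y $$ (r, t) = x $$ (r, t))"

lemma agree_belowD: "agree_below k x y \<Longrightarrow> r < n \<Longrightarrow> t < n \<Longrightarrow> k < blk r \<Longrightarrow> y $$ (r, t) = x $$ (r, t)"
  by (simp add: agree_below_def)

lemma agree_below_refl: "agree_below k x x"
  by (simp add: agree_below_def)

lemma agree_below_trans: "agree_below k x y \<Longrightarrow> agree_below k y z \<Longrightarrow> agree_below k x z"
  by (simp add: agree_below_def)

text \<open>The move is a \<open>conj\<close>. Its column part acts between two columns of block
  \<open>k\<close>, which are zero in all rows of block \<open>k\<close> or later, so only the row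
  part is visible there.\<close>

lemma add_row_in_block:
  fixes x :: "'a::field mat"
  assumes "x \<in> upper" "i < n" "p < n" "i \<noteq> p" "blk i = k" "blk p = k"
  obtains y where "step x y" "agree_below k x y"
    "\<And>r t. r < n \<Longrightarrow> t < n \<Longrightarrow> blk r = k \<Longrightarrow>
      y $$ (r, t) = x $$ (r, t) + (if r = i then c * x $$ (p, t) else 0)"
proof -
  have x: "x \<in> carrier_mat n n" by (rule upper_carrier[OF assms(1)])
  define z where "z = addcol (- c) p i x"
  define y where "y = addrow c i p z"
  have z: "z \<in> carrier_mat n n" using x by (simp add: z_def addcol_carrier)
  have zx: "z $$ (r, t) = x $$ (r, t)" if "r < n" "t < n" "k \<le> blk r" for r t
    unfolding z_def index_addcol[OF x that(1,2)]
    using upper_zero[OF assms(1) that(1) assms(2)] assms(5) that(3) by simp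
  have yx: "y $$ (r, t) = x $$ (r, t) + (if r = i then c * x $$ (p, t) else 0)"
    if "r < n" "t < n" "k \<le> blk r" for r t
    unfolding y_def index_addrow[OF z that(1,2)] zx[OF that]
    using zx[OF assms(3) that(2)] assms(6) by simp
  have "step x y"
    using step.conj[where i = i and j = p and c = "- c" and x = x] assms unfolding y_def z_def by simp
  moreover have "agree_below k x y" using yx assms(5) by (auto simp: agree_below_def)
  moreover have "y $$ (r, t) = x $$ (r, t) + (if r = i then c * x $$ (p, t) else 0)"
    if "r < n" "t < n" "blk r = k" for r t by (rule yx) (use that in simp_all)
  ultimately show thesis by (rule that)
qed

lemma add_rows_in_block:
  fixes x :: "'a::field mat"
  assumes "x \<in> upper" "p < n" "blk p = k" "finite S" "S \<subseteq> {r. r < n \<and> blk r = k \<and> r \<noteq> p}"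
  shows "\<exists>y. step\<^sup>*\<^sup>* x y \<and> agree_below k x y \<and> (\<forall>r<n. \<forall>t<n. blk r = k \<longrightarrow>
      y $$ (r, t) = x $$ (r, t) + (if r \<in> S then c r * x $$ (p, t) else 0))"
  using assms(4,5)
proof (induction S rule: finite_induct)
  case empty
  then show ?case by (intro exI[of _ x]) (simp add: agree_below_refl)
next
  case (insert i S)
  then obtain y where y: "step\<^sup>*\<^sup>* x y" "agree_below k x y" "\<forall>r<n. \<forall>t<n. blk r = k \<longrightarrow>
      y $$ (r, t) = x $$ (r, t) + (if r \<in> S then c r * x $$ (p, t) else 0)" by auto
  have i: "i < n" "i \<noteq> p" "blk i = k" "p \<notin> S" using insert.prems by auto
  obtain z where z: "step y z" "agree_below k y z"
    "\<And>r t. r < n \<Longrightarrow> t < n \<Longrightarrow> blk r = k \<Longrightarrow>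
      z $$ (r, t) = y $$ (r, t) + (if r = i then c i * y $$ (p, t) else 0)"
    using add_row_in_block[OF steps_upper[OF y(1) assms(1)] i(1) assms(2) i(2,3) assms(3)] by metis
  have "z $$ (r, t) = x $$ (r, t) + (if r \<in> insert i S then c r * x $$ (p, t) else 0)"
    if "r < n" "t < n" "blk r = k" for r t
    using z(3)[OF that] y(3) that assms(2,3) i insert.hyps(2) by auto
  then show ?case
    using rtranclp.rtrancl_into_rtrancl[of step, OF y(1) z(1)] agree_below_trans[OF y(2) z(2)] by blast
qed

text \<open>Column \<open>b\<close> is not hit, so it is zero below block \<open>k\<close> and
  adding it does no harm there. For different blocks this is a move by \<open>N\<close>; for equal
  ones row \<open>b\<close> is spoiled by row \<open>j\<close>, and the rank condition is what
  \<open>repair_row\<close> needs to undo this.\<close>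

lemma add_col_over_block:
  fixes x x0 :: "'a::field mat"
  assumes x0: "x0 \<in> upper" "rook_from (Suc k) x0"
    and x: "x \<in> upper" "agree_below k x0 x"
    and clear: "\<And>r t. r < n \<Longrightarrow> blk r = k \<Longrightarrow> t \<in> hit_cols k x0 \<Longrightarrow> x $$ (r, t) = 0"
    and b: "b < n" "b \<notin> hit_cols k x0" "k < blk b"
    and j: "j < n" "j \<notin> hit_cols k x0" "b \<noteq> j"
    and le: "rank x0 s b \<le> rank x0 s j"
  shows "\<exists>y. step\<^sup>*\<^sup>* x y \<and> agree_below k x0 y \<and> (\<forall>r<n. \<forall>t<n. blk r = k \<longrightarrow>
      y $$ (r, t) = x $$ (r, t) + (if t = j then c * x $$ (r, b) else 0))"
proof -
  have xc: "x \<in> carrier_mat n n" by (rule upper_carrier[OF x(1)])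
  define y where "y = addcol c j b x"
  have yc: "y \<in> carrier_mat n n" using xc by (simp add: y_def addcol_carrier)
  have yT: "y $$ (r, t) = x $$ (r, t) + (if t = j then c * x $$ (r, b) else 0)" if "r < n" "t < n" for r t
    unfolding y_def by (rule index_addcol[OF xc that])
  have "x $$ (r, b) = 0" if "r < n" "k < blk r" for r
    using b(1,2) that agree_belowD[OF x(2) that(1) b(1) that(2)] by (auto simp: hit_cols_def)
  then have yL: "y $$ (r, t) = x0 $$ (r, t)" if "r < n" "t < n" "k < blk r" for r t
    using that yT agree_belowD[OF x(2)] by simp
  \<comment> \<open>Ranks begin with the block, so the lexicographic order compares the blocks of
    \<open>b\<close> and \<open>j\<close> first.\<close>
  obtain lb lj where "rank x0 s b = blk b # lb" "rank x0 s j = blk j # lj"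
    using rank_hd by metis
  with le have "blk b \<le> blk j" by auto
  then consider "blk b < blk j" | "blk b = blk j" by linarith
  then show ?thesis
  proof cases
    case 1
    have "step x y" unfolding y_def by (rule step.col) (use b j 1 in auto)
    then show ?thesis using yT yL by (intro exI[of _ y]) (auto simp: agree_below_def)
  next
    case 2
    define z where "z = addrow (- c) b j y"
    have st: "step x z" unfolding z_def y_def by (rule step.conj) (use b j 2 in auto)
    have zL: "z $$ (r, t) = x0 $$ (r, t) + (if r = b then - c * x0 $$ (j, t) else 0)"
      if "r < n" "t < n" "k < blk r" for r t
      unfolding z_def index_addrow[OF yc that(1,2)] using yL that j(1) b(3) 2 by simp
    have zT: "z $$ (r, t) = y $$ (r, t)" if "r < n" "t < n" "blk r = k" for r t
      unfolding z_def index_addrow[OF yc that(1,2)] using b(3) that(3) by auto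
    \<comment> \<open>The only column changed in block \<open>k\<close> is \<open>j\<close>, which
      is not hit, so the cleared columns stay clear.\<close>
    have zh: "z $$ (r, t) = 0" if "r < n" "blk r = k" "t \<in> hit_cols k x0" for r t
    proof -
      have "t < n" "t \<noteq> j" using that(3) j(2) by (auto simp: hit_cols_def)
      then show ?thesis using zT[OF that(1) _ that(2)] yT[OF that(1)] clear[OF that] by simp
    qed
    have "\<exists>x'. step\<^sup>*\<^sup>* z x' \<and>
        (\<forall>r<n. \<forall>t<n. k < blk r \<longrightarrow> x' $$ (r, t) = x0 $$ (r, t)) \<and>
        (\<forall>r<n. \<forall>t<n. blk r = k \<longrightarrow> x' $$ (r, t) = z $$ (r, t))"
      by (rule repair_row[OF x0 step_upper[OF st x(1)] b(1) j(1) j(3) 2 b(3) _ le zL zh])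
        simp_all
    then obtain x' where x': "step\<^sup>*\<^sup>* z x'"
        "\<forall>r<n. \<forall>t<n. k < blk r \<longrightarrow> x' $$ (r, t) = x0 $$ (r, t)"
        "\<forall>r<n. \<forall>t<n. blk r = k \<longrightarrow> x' $$ (r, t) = z $$ (r, t)" by blast
    show ?thesis
      using x'(2,3) zT yT converse_rtranclp_into_rtranclp[of step, OF st x'(1)]
      by (intro exI[of _ x']) (simp add: agree_below_def)
  qed
qed

lemma add_cols_over_block:
  fixes x x0 :: "'a::field mat"
  assumes x0: "x0 \<in> upper" "rook_from (Suc k) x0"
    and x: "x \<in> upper" "agree_below k x0 x"
    and clear: "\<And>r t. r < n \<Longrightarrow> blk r = k \<Longrightarrow> t \<in> hit_cols k x0 \<Longrightarrow> x $$ (r, t) = 0"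
    and b: "b < n" "b \<notin> hit_cols k x0" "k < blk b"
    and S: "finite S" "S \<subseteq> {j. j < n \<and> j \<notin> hit_cols k x0 \<and> b \<noteq> j \<and> rank x0 s b \<le> rank x0 s j}"
  shows "\<exists>y. step\<^sup>*\<^sup>* x y \<and> agree_below k x0 y \<and> (\<forall>r<n. \<forall>t<n. blk r = k \<longrightarrow>
      y $$ (r, t) = x $$ (r, t) + (if t \<in> S then c t * x $$ (r, b) else 0))"
  using S
proof (induction S rule: finite_induct)
  case empty
  then show ?case using x(2) by (intro exI[of _ x]) simp
next
  case (insert j S)
  then obtain y where y: "step\<^sup>*\<^sup>* x y" "agree_below k x0 y" "\<forall>r<n. \<forall>t<n. blk r = k \<longrightarrow>
      y $$ (r, t) = x $$ (r, t) + (if t \<in> S then c t * x $$ (r, b) else 0)" by auto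
  have j: "j < n" "j \<notin> hit_cols k x0" "b \<noteq> j" "rank x0 s b \<le> rank x0 s j" "b \<notin> S"
    using insert.prems by auto
  have yh: "y $$ (r, t) = 0" if "r < n" "blk r = k" "t \<in> hit_cols k x0" for r t
  proof -
    have "t < n" "t \<notin> S" using that(3) insert.prems by (auto simp: hit_cols_def)
    then show ?thesis using y(3) clear[OF that] that by simp
  qed
  obtain z where z: "step\<^sup>*\<^sup>* y z" "agree_below k x0 z" "\<forall>r<n. \<forall>t<n. blk r = k \<longrightarrow>
      z $$ (r, t) = y $$ (r, t) + (if t = j then c j * y $$ (r, b) else 0)"
    using add_col_over_block[OF x0 steps_upper[OF y(1) x(1)] y(2) yh b j(1-4)] by metis
  have "z $$ (r, t) = x $$ (r, t) + (if t \<in> insert j S then c t * x $$ (r, b) else 0)"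
    if "r < n" "t < n" "blk r = k" for r t
    using z(3) y(3) that j b(1) insert.hyps(2) by auto
  then show ?case using rtranclp_trans[of step, OF y(1) z(1)] z(2) by blast
qed

section \<open>Reduction of one row block, then of the whole matrix\<close>

text \<open>A hit column has a pivot in some row \<open>p\<close> below block \<open>k\<close>. That
  pivot is the only nonzero entry of row \<open>p\<close>, so subtracting a multiple of the row
  changes a single entry, and the positions in \<open>S\<close> can be cleared one by one.\<close>

lemma clear_hit_cols:
  fixes x0 :: "'a::field mat"
  assumes x0: "x0 \<in> upper" "rook_from (Suc k) x0"
    and S: "finite S" "S \<subseteq> {r. r < n \<and> blk r = k} \<times> hit_cols k x0"
  shows "\<exists>x. step\<^sup>*\<^sup>* x0 x \<and> agree_below k x0 x \<and> (\<forall>r<n. \<forall>t<n. blk r = k \<longrightarrow>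
      x $$ (r, t) = (if (r, t) \<in> S then 0 else x0 $$ (r, t)))"
  using S
proof (induction S rule: finite_induct)
  case empty
  then show ?case by (intro exI[of _ x0]) (simp add: agree_below_refl)
next
  case (insert e S)
  obtain i j where e: "e = (i, j)" by (cases e)
  obtain x where x: "step\<^sup>*\<^sup>* x0 x" "agree_below k x0 x" "\<forall>r<n. \<forall>t<n. blk r = k \<longrightarrow>
      x $$ (r, t) = (if (r, t) \<in> S then 0 else x0 $$ (r, t))"
    using insert.IH insert.prems by blast
  have ij: "i < n" "blk i = k" "j \<in> hit_cols k x0" using insert.prems by (auto simp: e)
  then obtain p where p: "p < n" "k < blk p" "x0 $$ (p, j) \<noteq> 0" and j: "j < n"
    by (auto simp: hit_cols_def)
  have xp: "x $$ (p, t) = (if t = j then x0 $$ (p, j) else 0)" if "t < n" for t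
  proof -
    have "x0 $$ (p, t) \<noteq> 0 \<Longrightarrow> t = j"
      using x0(2) p j that unfolding rook_from_def Suc_le_eq by blast
    then show ?thesis using agree_belowD[OF x(2) p(1) that p(2)] by auto
  qed
  define y where "y = addrow (- x $$ (i, j) / x0 $$ (p, j)) i p x"
  have st: "step x y" unfolding y_def by (rule step.row) (use ij p in auto)
  have y: "y $$ (r, t) = (if r = i \<and> t = j then 0 else x $$ (r, t))" if "r < n" "t < n" for r t
    unfolding y_def index_addrow[OF upper_carrier[OF steps_upper[OF x(1) x0(1)]] that] xp[OF that(2)]
    using p(3) by simp
  have "agree_below k x0 y" using x(2) y ij(2) by (auto simp: agree_below_def)
  moreover have "y $$ (r, t) = (if (r, t) \<in> insert e S then 0 else x0 $$ (r, t))"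
    if "r < n" "t < n" "blk r = k" for r t
    using y x(3) that by (auto simp: e)
  ultimately show ?case
    using rtranclp.rtrancl_into_rtrancl[of step, OF x(1) st] by blast
qed

text \<open>\<open>F\<close> is the set of rows of block \<open>k\<close> that already have an isolated pivot.\<close>

lemma pivot_block:
  fixes x x0 :: "'a::field mat"
  assumes x0: "x0 \<in> upper" "rook_from (Suc k) x0"
  shows "x \<in> upper \<Longrightarrow> agree_below k x0 x \<Longrightarrow>
    (\<And>r t. r < n \<Longrightarrow> blk r = k \<Longrightarrow> t \<in> hit_cols k x0 \<Longrightarrow> x $$ (r, t) = 0) \<Longrightarrow>
    F \<subseteq> {r. r < n \<and> blk r = k} \<Longrightarrow>
    (\<And>r t t'. r \<in> F \<Longrightarrow> t < n \<Longrightarrow> t' < n \<Longrightarrow> x $$ (r, t) \<noteq> 0 \<Longrightarrow> x $$ (r, t') \<noteq> 0 \<Longrightarrow> t = t') \<Longrightarrow>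
    (\<And>r r' t. r \<in> F \<Longrightarrow> r' < n \<Longrightarrow> blk r' = k \<Longrightarrow> t < n \<Longrightarrow> x $$ (r, t) \<noteq> 0 \<Longrightarrow> x $$ (r', t) \<noteq> 0 \<Longrightarrow> r = r') \<Longrightarrow>
    \<exists>y. step\<^sup>*\<^sup>* x y \<and> rook_from k y"
\<comment> \<open>Each round moves one more row into \<open>F\<close>, which has at most
  \<open>n\<close> elements.\<close>
proof (induction "n - card F" arbitrary: F x rule: less_induct)
  case less
  note x = less.prems(1,2) and clear = less.prems(3) and F = less.prems(4-6)
  let ?T = "{r. r < n \<and> blk r = k}"
  let ?C = "{t. t < n \<and> (\<exists>r \<in> ?T - F. x $$ (r, t) \<noteq> 0)}"
  show ?case
  proof (cases "?C = {}")
    case True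
    have nz: "r \<in> F" if "r < n" "blk r = k" "t < n" "x $$ (r, t) \<noteq> 0" for r t
    proof (rule ccontr)
      assume "r \<notin> F"
      with that have "t \<in> ?C" by blast
      with True show False by blast
    qed
    \<comment> \<open>A column shared with a lower row is hit, and hit columns vanish in block
      \<open>k\<close>.\<close>
    have cross: False if "r < n" "blk r = k" "r' < n" "k < blk r'" "t < n"
      "x $$ (r, t) \<noteq> 0" "x $$ (r', t) \<noteq> 0" for r r' t
      using clear[OF that(1,2), of t] that agree_belowD[OF x(2) that(3,5,4)] by (auto simp: hit_cols_def)
    have "t = t'" if "r < n" "t < n" "t' < n" "k \<le> blk r" "x $$ (r, t) \<noteq> 0" "x $$ (r, t') \<noteq> 0" for r t t'
    proof (cases "blk r = k")
      case True
      then show ?thesis using F(2)[OF nz] that by blast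
    next
      case False
      then have "k < blk r" using that(4) by simp
      then show ?thesis
        using x0(2) that unfolding rook_from_def Suc_le_eq
          agree_belowD[OF x(2) that(1,2) \<open>k < blk r\<close>] agree_belowD[OF x(2) that(1,3) \<open>k < blk r\<close>] by blast
    qed
    moreover have "r = r'" if "r < n" "r' < n" "t < n" "k \<le> blk r" "k \<le> blk r'"
      "x $$ (r, t) \<noteq> 0" "x $$ (r', t) \<noteq> 0" for r r' t
    proof -
      have "blk r = k \<longleftrightarrow> blk r' = k"
        using cross[OF that(1) _ that(2) _ that(3,6,7)] cross[OF that(2) _ that(1) _ that(3,7,6)] that(4,5)
        by (metis order_le_imp_less_or_eq)
      then consider "blk r = k" "blk r' = k" | "k < blk r" "k < blk r'"
        using \<open>k \<le> blk r\<close> \<open>k \<le> blk r'\<close> by linarith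
      then show ?thesis
      proof cases
        case 1
        then show ?thesis using F(3)[OF nz] that by blast
      next
        case 2
        then show ?thesis
          using x0(2) that unfolding rook_from_def Suc_le_eq
            agree_belowD[OF x(2) that(1,3) 2(1)] agree_belowD[OF x(2) that(2,3) 2(2)] by blast
      qed
    qed
    ultimately have "rook_from k x" unfolding rook_from_def by metis
    then show ?thesis by blast
  next
    case False
    have fin: "finite ?C" by (rule finite_subset[of _ "{..<n}"]) (blast, simp)
    \<comment> \<open>Least rank allows column \<open>b\<close> to be added to every other column in
      which its pivot row is nonzero.\<close>
    obtain b where b: "b \<in> ?C" "\<And>t. t \<in> ?C \<Longrightarrow> rank x0 s b \<le> rank x0 s t"
      using arg_min_if_finite(1)[OF fin False, of "rank x0 s"]
        arg_min_least[OF fin False, of _ "rank x0 s"] by (rule that)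
    from b(1) obtain p where p: "p < n" "blk p = k" "p \<notin> F" "x $$ (p, b) \<noteq> 0" and bn: "b < n" by blast
    have kb: "k < blk b" using x(1) p bn by (auto simp: upper_def)
    have b_unhit: "b \<notin> hit_cols k x0" using clear p by blast
    \<comment> \<open>Otherwise the isolated pivot of row \<open>r\<close> would share its column
      with row \<open>p\<close>. Hence rows in \<open>F\<close> get coefficient zero in the
      elimination that follows.\<close>
    have Fb: "x $$ (r, b) = 0" if "r \<in> F" for r using F(3)[OF that p(1,2) bn] p(3,4) that by blast
    obtain y where y: "step\<^sup>*\<^sup>* x y" "agree_below k x y" and "\<forall>r<n. \<forall>t<n. blk r = k \<longrightarrow>
        y $$ (r, t) = x $$ (r, t) + (if r \<in> ?T - {p} then (- x $$ (r, b) / x $$ (p, b)) * x $$ (p, t) else 0)"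
      using add_rows_in_block[OF x(1) p(1,2), of "?T - {p}" "\<lambda>r. - x $$ (r, b) / x $$ (p, b)"] by auto
    then have yT: "y $$ (r, t) = x $$ (r, t) - (if r \<noteq> p then x $$ (r, b) / x $$ (p, b) * x $$ (p, t) else 0)"
      if "r < n" "t < n" "blk r = k" for r t using that by simp
    have yb: "y $$ (r, b) = (if r = p then x $$ (p, b) else 0)" if "r < n" "blk r = k" for r
      using yT[OF that(1) bn that(2)] p(4) by simp
    have yh: "y $$ (r, t) = 0" if "r < n" "blk r = k" "t \<in> hit_cols k x0" for r t
      using yT[OF that(1) _ that(2)] clear[OF that] clear[OF p(1,2) that(3)] that(3)
      by (auto simp: hit_cols_def)
    have yu: "y \<in> upper" by (rule steps_upper[OF y(1) x(1)])
    \<comment> \<open>The other entries of the pivot row. In block \<open>k\<close>, column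
      \<open>b\<close> is now zero outside row \<open>p\<close>, so clearing them by column
      additions affects no other row of the block.\<close>
    let ?S = "{t. t < n \<and> t \<noteq> b \<and> x $$ (p, t) \<noteq> 0}"
    have S: "?S \<subseteq> {j. j < n \<and> j \<notin> hit_cols k x0 \<and> b \<noteq> j \<and> rank x0 s b \<le> rank x0 s j}"
    proof
      fix t assume "t \<in> ?S"
      then have t: "t < n" "t \<noteq> b" "x $$ (p, t) \<noteq> 0" by simp_all
      then have "t \<in> ?C" using p by blast
      with t b(2) clear[OF p(1,2)] show "t \<in> {j. j < n \<and> j \<notin> hit_cols k x0 \<and> b \<noteq> j \<and> rank x0 s b \<le> rank x0 s j}"
        by blast
    qed
    have "\<exists>z. step\<^sup>*\<^sup>* y z \<and> agree_below k x0 z \<and> (\<forall>r<n. \<forall>t<n. blk r = k \<longrightarrow>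
        z $$ (r, t) = y $$ (r, t) + (if t \<in> ?S then (- x $$ (p, t) / x $$ (p, b)) * y $$ (r, b) else 0))"
      by (rule add_cols_over_block[OF x0 yu agree_below_trans[OF x(2) y(2)] yh bn b_unhit kb _ S]) simp_all
    then obtain z where z: "step\<^sup>*\<^sup>* y z" "agree_below k x0 z" "\<forall>r<n. \<forall>t<n. blk r = k \<longrightarrow>
        z $$ (r, t) = y $$ (r, t) + (if t \<in> ?S then (- x $$ (p, t) / x $$ (p, b)) * y $$ (r, b) else 0)" by blast
    have zT: "z $$ (r, t) = (if r = p then if t = b then x $$ (p, b) else 0
        else x $$ (r, t) - x $$ (r, b) / x $$ (p, b) * x $$ (p, t))"
      if "r < n" "t < n" "blk r = k" for r t
      using z(3) yb[OF that(1,3)] yT[OF that] that p(4) by auto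
    have zF: "z $$ (r, t) = x $$ (r, t)" if "r \<in> F" "t < n" for r t
      using zT[of r t] Fb[OF that(1)] F(1) that p(3) by auto
    have zb: "z $$ (r, b) = (if r = p then x $$ (p, b) else 0)" if "r < n" "blk r = k" for r
      using zT[OF that(1) bn that(2)] p(4) by simp
    have "\<exists>w. step\<^sup>*\<^sup>* z w \<and> rook_from k w"
    proof (rule less.hyps[of "insert p F"])
      have "finite F" using F(1) finite_subset by fastforce
      moreover have "insert p F \<subseteq> {..<n}" using F(1) p by auto
      then have "card (insert p F) \<le> n" using card_mono[of "{..<n}" "insert p F"] by simp
      ultimately show "n - card (insert p F) < n - card F" using p(3) by simp
      show "z \<in> upper" by (rule steps_upper[OF z(1) yu])
      show "z $$ (r, t) = 0" if "r < n" "blk r = k" "t \<in> hit_cols k x0" for r t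
        using zT[OF that(1) _ that(2)] clear[OF that] clear[OF p(1,2) that(3)] that(3) b_unhit
        by (auto simp: hit_cols_def)
      show "insert p F \<subseteq> ?T" using F(1) p by simp
      show "t = t'" if "r \<in> insert p F" "t < n" "t' < n" "z $$ (r, t) \<noteq> 0" "z $$ (r, t') \<noteq> 0" for r t t'
        using that zT[OF p(1) _ p(2)] zF F(2) by (auto split: if_splits)
      show "r = r'" if "r \<in> insert p F" "r' < n" "blk r' = k" "t < n"
        "z $$ (r, t) \<noteq> 0" "z $$ (r', t) \<noteq> 0" for r r' t
      proof (cases "r = p")
        case True
        then have "t = b" using zT[OF p(1) that(4) p(2)] that(5) by (auto split: if_splits)
        then show ?thesis using zb[OF that(2,3)] that(6) True by (auto split: if_splits)
      next
        case False
        then have r: "r \<in> F" "x $$ (r, t) \<noteq> 0" using that(1,4,5) zF by auto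
        then have "x $$ (p, t) = 0" "r' \<noteq> r \<Longrightarrow> x $$ (r', t) = 0"
          using F(3)[OF r(1) _ _ that(4) r(2)] p that by blast+
        moreover have "t \<noteq> b" using Fb r by blast
        ultimately show ?thesis using zT[OF that(2,4,3)] that(6) by (auto split: if_splits)
      qed
    qed (rule z(2))
    then show ?thesis using rtranclp_trans[of step, OF rtranclp_trans[of step, OF y(1) z(1)]] by blast
  qed
qed

lemma reduce_block:
  fixes x0 :: "'a::field mat"
  assumes "x0 \<in> upper" "rook_from (Suc k) x0"
  shows "\<exists>y. step\<^sup>*\<^sup>* x0 y \<and> rook_from k y"
proof -
  let ?S = "{r. r < n \<and> blk r = k} \<times> hit_cols k x0"
  have "finite ?S" by (simp add: hit_cols_def)
  then obtain x where x: "step\<^sup>*\<^sup>* x0 x" "agree_below k x0 x" "\<forall>r<n. \<forall>t<n. blk r = k \<longrightarrow>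
      x $$ (r, t) = (if (r, t) \<in> ?S then 0 else x0 $$ (r, t))"
    using clear_hit_cols[OF assms, of ?S] by blast
  have "\<exists>y. step\<^sup>*\<^sup>* x y \<and> rook_from k y"
    by (rule pivot_block[where F = "{}", OF assms steps_upper[OF x(1) assms(1)] x(2)])
      (use x(3) in \<open>auto simp: hit_cols_def\<close>)
  then show ?thesis using rtranclp_trans[of step, OF x(1)] by blast
qed

lemma reduce_to_rook:
  fixes x :: "'a::field mat"
  assumes "x \<in> upper"
  shows "\<exists>y. step\<^sup>*\<^sup>* x y \<and> rook_from 0 y"
proof -
  have "\<exists>y. step\<^sup>*\<^sup>* x y \<and> rook_from k y" if "k \<le> s" for k
    using that
  proof (induction k rule: inc_induct)
    case base
    \<comment> \<open>No row lies in block \<open>s\<close> or later.\<close>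
    have "rook_from s x" using blk_less by (fastforce simp: rook_from_def)
    then show ?case by blast
  next
    case (step k)
    then obtain y where y: "step\<^sup>*\<^sup>* x y" "rook_from (Suc k) y" by blast
    from reduce_block[OF steps_upper[OF y(1) assms] y(2)] obtain z where "step\<^sup>*\<^sup>* y z" "rook_from k z"
      by blast
    then show ?case using rtranclp_trans[of "block_structure.step n blk", OF y(1)] by blast
  qed
  then show ?thesis by simp
qed

section \<open>Moves realised by the groups \<open>R\<close> and \<open>N\<close>\<close>

text \<open>The group \<open>N = 1 + J\<close>, given entrywise so that row and column additions can
  be checked position by position.\<close>

definition radical :: "'a::field mat set" where
  "radical = {a \<in> carrier_mat n n. \<forall>i<n. \<forall>j<n.
     \<not> blk i < blk j \<longrightarrow> a $$ (i, j) = (if i = j then 1 else 0)}"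

text \<open>The matrices of \<open>R\<close> up to invertibility, which \<open>conjugate\<close>
  supplies through the explicit inverse \<open>r'\<close>.\<close>

definition block_diagonal :: "'a::field mat set" where
  "block_diagonal = {g \<in> carrier_mat n n. \<forall>i<n. \<forall>j<n. blk i \<noteq> blk j \<longrightarrow> g $$ (i, j) = 0}"

lemma radical_carrier: "a \<in> radical \<Longrightarrow> a \<in> carrier_mat n n"
  by (simp add: radical_def)

lemma radicalD: "a \<in> radical \<Longrightarrow> i < n \<Longrightarrow> j < n \<Longrightarrow> \<not> blk i < blk j \<Longrightarrow>
    a $$ (i, j) = (if i = j then 1 else 0)"
  by (simp add: radical_def)

lemma addcol_radical:
  assumes a: "a \<in> radical" and ij: "i < n" "j < n" "blk i < blk j"
  shows "addcol c j i a \<in> radical"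
proof -
  have "addcol c j i a $$ (r, t) = (if r = t then 1 else 0)" if "r < n" "t < n" "\<not> blk r < blk t" for r t
    unfolding index_addcol[OF radical_carrier[OF a] that(1,2)]
    using radicalD[OF a that] radicalD[OF a that(1) ij(1)] ij(3) that(3) by (auto split: if_splits)
  then show ?thesis using radical_carrier[OF a] by (auto simp: radical_def addcol_carrier)
qed

lemma addrow_radical:
  assumes a: "a \<in> radical" and ij: "i < n" "j < n" "blk i < blk j"
  shows "addrow c i j a \<in> radical"
proof -
  have "addrow c i j a $$ (r, t) = (if r = t then 1 else 0)" if "r < n" "t < n" "\<not> blk r < blk t" for r t
    unfolding index_addrow[OF radical_carrier[OF a] that(1,2)]
    using radicalD[OF a that] radicalD[OF a ij(2) that(2)] ij(3) that(3) by (auto split: if_splits)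
  then show ?thesis using radical_carrier[OF a] by (auto simp: radical_def)
qed

text \<open>\<open>R\<close> normalises \<open>N\<close>. This is the case of an elementary matrix
  of \<open>R\<close>, which lets a \<open>conj\<close> move be carried past the factors from
  \<open>N\<close>.\<close>

lemma conj_radical:
  assumes a: "a \<in> radical" and ij: "i < n" "j < n" "i \<noteq> j" "blk i = blk j"
  shows "addcol (- c) j i (addrow c i j a) \<in> radical"
proof -
  have c: "addrow c i j a \<in> carrier_mat n n" using radical_carrier[OF a] by simp
  have "addcol (- c) j i (addrow c i j a) $$ (r, t) = (if r = t then 1 else 0)"
    if "r < n" "t < n" "\<not> blk r < blk t" for r t
    unfolding index_addcol[OF c that(1,2)] index_addrow[OF radical_carrier[OF a] that(1,2)]
      index_addrow[OF radical_carrier[OF a] that(1) ij(1)]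
    using radicalD[OF a that] radicalD[OF a ij(2) that(2)] radicalD[OF a that(1) ij(1)]
      radicalD[OF a ij(2,1)] ij(3,4) that(3) by auto
  then show ?thesis using c by (auto simp: radical_def addcol_carrier)
qed

lemma addcol_block_diagonal:
  assumes g: "g \<in> block_diagonal" and ij: "i < n" "j < n" "blk i = blk j"
  shows "addcol c j i g \<in> block_diagonal"
proof -
  have gc: "g \<in> carrier_mat n n" using g by (simp add: block_diagonal_def)
  have "addcol c j i g $$ (r, t) = 0" if "r < n" "t < n" "blk r \<noteq> blk t" for r t
    unfolding index_addcol[OF gc that(1,2)] using g ij that by (auto simp: block_diagonal_def)
  then show ?thesis using gc by (auto simp: block_diagonal_def addcol_carrier)
qed

definition conjugate :: "'a::field mat \<Rightarrow> 'a mat \<Rightarrow> bool" where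
  "conjugate x y \<longleftrightarrow> (\<exists>r \<in> block_diagonal. \<exists>r' \<in> carrier_mat n n. \<exists>a \<in> radical. \<exists>b \<in> radical.
     r * r' = 1\<^sub>m n \<and> r' * r = 1\<^sub>m n \<and> y = r * a * x * b * r')"

text \<open>The new factor is absorbed next to \<open>x\<close>: a \<open>row\<close> move into
  \<open>a\<close>, a \<open>col\<close> move into \<open>b\<close>. A \<open>conj\<close> move
  turns \<open>x\<close> into \<open>f x e\<close> with \<open>e\<close> and \<open>f\<close>
  inverse to each other, and \<open>r a f x e b r'\<close> regroups as
  \<open>(r f) (e a f) x (e b f) (e r')\<close>.\<close>

lemma step_conjugate:
  fixes x y z :: "'a::field mat"
  assumes "step x y" "x \<in> carrier_mat n n" "conjugate y z"
  shows "conjugate x z"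
proof -
  obtain r r' a b where r: "r \<in> block_diagonal" and r'[simp]: "r' \<in> carrier_mat n n"
    and a: "a \<in> radical" and b: "b \<in> radical"
    and inv: "r * r' = 1\<^sub>m n" "r' * r = 1\<^sub>m n" and z: "z = r * a * y * b * r'"
    using assms(3) unfolding conjugate_def by blast
  have [simp]: "r \<in> carrier_mat n n" using r by (simp add: block_diagonal_def)
  note [simp] = radical_carrier[OF a] radical_carrier[OF b] assms(2)
  note [simp] = assoc_mult_mat[of _ n n _ n _ n] mult_carrier_mat[of _ n n _ n]
  from assms(1) show ?thesis
  proof cases
    case (row i j c)
    define e where "e = addrow_mat n c i j"
    have [simp]: "e \<in> carrier_mat n n" by (simp add: e_def)
    have "a * e \<in> radical"
      using addcol_radical[OF a row(2-4), of c] addcol_mat[OF radical_carrier[OF a] row(2), of c j]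
      by (simp add: e_def)
    moreover have "y = e * x"
      unfolding row(1) e_def by (rule addrow_mat[OF assms(2) row(3)])
    then have "z = r * (a * e) * x * b * r'" by (simp add: z)
    ultimately show ?thesis using r r' b inv unfolding conjugate_def by blast
  next
    case (col i j c)
    define e where "e = addrow_mat n c i j"
    have [simp]: "e \<in> carrier_mat n n" by (simp add: e_def)
    have "e * b \<in> radical"
      using addrow_radical[OF b col(2-4), of c] addrow_mat[OF radical_carrier[OF b] col(3), of c i]
      by (simp add: e_def)
    moreover have "y = x * e"
      unfolding col(1) e_def by (rule addcol_mat[OF assms(2) col(2)])
    then have "z = r * a * x * (e * b) * r'" by (simp add: z)
    ultimately show ?thesis using r r' a inv unfolding conjugate_def by blast
  next
    case (conj i j c)
    define e where "e = addrow_mat n c i j"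
    define f where "f = addrow_mat n (- c) i j"
    have [simp]: "e \<in> carrier_mat n n" "f \<in> carrier_mat n n" by (simp_all add: e_def f_def)
    have ef: "e * f = 1\<^sub>m n" "f * e = 1\<^sub>m n"
      using addrow_mat_inv[OF conj(2-4), of c] addrow_mat_inv[OF conj(2-4), of "- c"]
      by (simp_all add: e_def f_def)
    \<comment> \<open>Products are associated to the right by the simplifier, so inverse pairs are
      cancelled in front of a tail \<open>w\<close>.\<close>
    have cancel: "f * (e * w) = w" "e * (f * w) = w" if "w \<in> carrier_mat n n" for w
      using that ef assoc_mult_mat[of f n n e n w n] assoc_mult_mat[of e n n f n w n] by simp_all
    have cancel': "r * (r' * w) = w" "r' * (r * w) = w" if "w \<in> carrier_mat n n" for w
      using that inv assoc_mult_mat[of r n n r' n w n] assoc_mult_mat[of r' n n r n w n] by simp_all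
    have conj_radical': "e * w * f \<in> radical" if w: "w \<in> radical" for w
    proof -
      have "addrow c i j w = e * w"
        unfolding e_def by (rule addrow_mat[OF radical_carrier[OF w] conj(3)])
      moreover have "addcol (- c) j i (e * w) = e * w * f"
        unfolding f_def by (rule addcol_mat[OF _ conj(2), where nr = n]) (simp add: radical_carrier[OF w])
      ultimately show ?thesis using conj_radical[OF w conj(2-5), of c] by simp
    qed
    have "addcol c j i x = x * e" unfolding e_def by (rule addcol_mat[OF assms(2) conj(2)])
    moreover have "addrow (- c) i j (x * e) = f * (x * e)"
      unfolding f_def by (rule addrow_mat[OF _ conj(3), where nc = n]) simp
    ultimately have "y = f * (x * e)" using conj(1) by simp
    then have "z = (r * f) * (e * a * f) * x * (e * b * f) * (e * r')"
      by (simp add: z cancel)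
    moreover have "r * f \<in> block_diagonal"
      using addcol_block_diagonal[OF r conj(2,3,5), of "- c"] addcol_mat[of r n n i "- c" j] conj(2)
      by (simp add: f_def)
    moreover have "(r * f) * (e * r') = 1\<^sub>m n" "(e * r') * (r * f) = 1\<^sub>m n"
      using inv ef by (simp_all add: cancel cancel')
    moreover have "e * r' \<in> carrier_mat n n" by simp
    ultimately show ?thesis
      using conj_radical'[OF a] conj_radical'[OF b] unfolding conjugate_def by blast
  qed
qed

text \<open>The induction prepends moves, because \<open>step_conjugate\<close> absorbs a move on
  the side of \<open>x\<close>.\<close>

lemma steps_conjugate:
  fixes x y :: "'a::field mat"
  assumes "step\<^sup>*\<^sup>* x y" "x \<in> upper"
  shows "conjugate x y"
  using assms
proof (induction rule: converse_rtranclp_induct)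
  case base
  have "1\<^sub>m n \<in> block_diagonal" "1\<^sub>m n \<in> radical" by (auto simp: block_diagonal_def radical_def)
  moreover have "y = 1\<^sub>m n * 1\<^sub>m n * y * 1\<^sub>m n * 1\<^sub>m n" using upper_carrier[OF base] by simp
  ultimately show ?case unfolding conjugate_def
    by (metis left_mult_one_mat one_carrier_mat)
next
  case (step x z)
  then show ?case using step_conjugate[OF step(1) upper_carrier] step_upper by blast
qed

end

section \<open>Blocks as segments of a list of sizes\<close>

text \<open>The least such \<open>k\<close> skips empty blocks, so the index lands in the segment
  containing it even when some sizes are \<open>0\<close>.\<close>

definition block_of :: "nat list \<Rightarrow> nat \<Rightarrow> nat" where
  "block_of ns i = (LEAST k. i < sum_list (take (Suc k) ns))"

lemma block_of_less:
  assumes "i < sum_list ns"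
  shows "block_of ns i < length ns"
proof -
  have "ns \<noteq> []" using assms by auto
  then have "i < sum_list (take (Suc (length ns - 1)) ns)" using assms by simp
  then have "block_of ns i \<le> length ns - 1" unfolding block_of_def by (rule Least_le)
  with \<open>ns \<noteq> []\<close> show ?thesis by (cases ns) auto
qed

lemma sum_list_take_mono: "k \<le> l \<Longrightarrow> sum_list (take k ns) \<le> sum_list (take l ns)" for ns :: "nat list"
  by (metis le_add1 le_add_diff_inverse sum_list.append take_add)

lemma segment_iff:
  assumes "i < sum_list ns"
  shows "i \<in> segment ns k \<longleftrightarrow> block_of ns i = k"
proof -
  have ex: "i < sum_list (take (Suc (length ns)) ns)" using assms by simp
  have ub: "i < sum_list (take (Suc (block_of ns i)) ns)"
    unfolding block_of_def by (rule LeastI[of "\<lambda>k. i < sum_list (take (Suc k) ns)", OF ex])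
  have lb: "sum_list (take (block_of ns i) ns) \<le> i"
  proof (cases "block_of ns i")
    case (Suc m)
    \<comment> \<open>Minimality, applied one block earlier, gives the lower end of the
      segment.\<close>
    then have "\<not> i < sum_list (take (Suc m) ns)"
      using not_less_Least[of m "\<lambda>k. i < sum_list (take (Suc k) ns)"] unfolding block_of_def by simp
    then show ?thesis using Suc by simp
  qed simp
  have "block_of ns i = k" if "i \<in> segment ns k"
  proof (rule antisym)
    show "block_of ns i \<le> k"
      unfolding block_of_def by (rule Least_le) (use that in \<open>simp add: segment_def\<close>)
    show "k \<le> block_of ns i"
    proof (rule ccontr)
      assume "\<not> k \<le> block_of ns i"
      then have "sum_list (take (Suc (block_of ns i)) ns) \<le> sum_list (take k ns)"
        by (intro sum_list_take_mono) simp
      then show False using ub that by (simp add: segment_def)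
    qed
  qed
  with lb ub show ?thesis by (auto simp: segment_def)
qed

lemma segment_less: "i \<in> segment ns k \<Longrightarrow> i < sum_list ns"
  \<comment> \<open>The \<open>max\<close> also covers \<open>k\<close> beyond the end of the list,
    where \<open>take\<close> returns the whole list.\<close>
  using sum_list_take_mono[of "Suc k" "max (Suc k) (length ns)" ns] by (simp add: segment_def)

lemma Delta_J_iff: "(i, j) \<in> Delta_J ns \<longleftrightarrow> i < sum_list ns \<and> j < sum_list ns \<and> block_of ns i < block_of ns j"
proof
  assume "(i, j) \<in> Delta_J ns"
  then obtain k l where kl: "i \<in> segment ns k" "j \<in> segment ns l" "k < l"
    unfolding Delta_J_def by blast
  then show "i < sum_list ns \<and> j < sum_list ns \<and> block_of ns i < block_of ns j"
    using segment_less[OF kl(1)] segment_less[OF kl(2)] by (simp add: segment_iff)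
next
  assume *: "i < sum_list ns \<and> j < sum_list ns \<and> block_of ns i < block_of ns j"
  then have "(i, j) \<in> segment ns (block_of ns i) \<times> segment ns (block_of ns j)" by (simp add: segment_iff)
  with * show "(i, j) \<in> Delta_J ns" unfolding Delta_J_def using block_of_less by blast
qed

interpretation segments: block_structure "sum_list ns" "length ns" "block_of ns" for ns
  by unfold_locales (rule block_of_less)

lemma nil_algebra_eq: "nil_algebra ns = segments.upper ns"
  by (auto simp: nil_algebra_def segments.upper_def Delta_J_iff)

lemma radical_subset: "segments.radical ns \<subseteq> unipotent_radical ns"
proof
  fix a :: "'a mat" assume a: "a \<in> segments.radical ns"
  let ?u = "a - 1\<^sub>m (sum_list ns)"
  have "a \<in> carrier_mat (sum_list ns) (sum_list ns)" using a by (simp add: segments.radical_def)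
  moreover from this have "?u \<in> nil_algebra ns"
    using a by (auto simp: nil_algebra_def Delta_J_iff segments.radical_def)
  moreover from calculation have "a = 1\<^sub>m (sum_list ns) + ?u" by (intro eq_matI) auto
  ultimately show "a \<in> unipotent_radical ns" unfolding unipotent_radical_def by blast
qed

lemma conjugate_equivalent:
  assumes "segments.conjugate ns x y"
  shows "equivalent ns x y"
proof -
  obtain r r' a b where r: "r \<in> segments.block_diagonal ns"
    and r': "r' \<in> carrier_mat (sum_list ns) (sum_list ns)"
    and ab: "a \<in> unipotent_radical ns" "b \<in> unipotent_radical ns"
    and inv: "r * r' = 1\<^sub>m (sum_list ns)" "r' * r = 1\<^sub>m (sum_list ns)" and y: "y = r * a * x * b * r'"
    using assms radical_subset unfolding segments.conjugate_def by blast
  have rc: "r \<in> carrier_mat (sum_list ns) (sum_list ns)" using r by (simp add: segments.block_diagonal_def)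
  have invm: "inverts_mat r r'" "inverts_mat r' r" using inv rc r' by (auto simp: inverts_mat_def)
  then have "invertible_mat r" using rc by (auto simp: invertible_mat_def)
  \<comment> \<open>This serves both the parabolic condition and the block-diagonal one.\<close>
  moreover have "r $$ (i, j) = 0" if "i \<in> segment ns k" "j \<in> segment ns l" "k \<noteq> l" for i j k l
    using r that segment_less[OF that(1)] segment_less[OF that(2)]
    by (auto simp: segments.block_diagonal_def segment_iff)
  ultimately have "r \<in> levi_subgroup ns" using rc by (auto simp: levi_subgroup_def parabolic_def)
  with r' ab invm y show ?thesis unfolding equivalent_def by blast
qed

section \<open>Block-rooks of size one\<close>

lemma det_submatrix_singleton:
  assumes "i < dim_row A" "j < dim_col A"
  shows "det (submatrix A {i} {j}) = A $$ (i, j)"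
proof -
  have "{i'. i' < dim_row A \<and> i' \<in> {i}} = {i}" "{j'. j' < dim_col A \<and> j' \<in> {j}} = {j}"
    using assms by auto
  then have "submatrix A {i} {j} \<in> carrier_mat 1 1"
    by (intro carrier_matI) (simp_all only: dim_submatrix card.empty card_insert_disjoint finite.emptyI empty_iff not_False_eq_True One_nat_def)
  moreover have "{a \<in> {i}. a < i} = {}" "{a \<in> {j}. a < j} = {}" by auto
  with submatrix_index_card[OF assms, of "{i}" "{j}"] have "submatrix A {i} {j} $$ (0, 0) = A $$ (i, j)"
    by (simp only: card.empty insertI1 simp_thms)
  ultimately show ?thesis by (simp add: det_single)
qed

text \<open>In rook form no two cells of the support share a row or a column, so each cell is a
  block-rook of its own, non-degenerate because its entry is nonzero.\<close>

lemma rook_associated: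
  assumes y: "y \<in> nil_algebra ns" and rook: "segments.rook_from ns 0 y"
  defines "D \<equiv> {(i, j). i < sum_list ns \<and> j < sum_list ns \<and> y $$ (i, j) \<noteq> 0}"
  shows "block_rook_placement ns D" "associated ns D y"
proof -
  have yc: "dim_row y = sum_list ns" "dim_col y = sum_list ns" using y by (auto simp: nil_algebra_def)
  have D: "D \<subseteq> Delta_J ns" using y by (auto simp: D_def nil_algebra_def)
  have row: "j = j'" if "(i, j) \<in> D" "(i, j') \<in> D" for i j j'
    using that rook unfolding segments.rook_from_def D_def by blast
  have col: "i = i'" if "(i, j) \<in> D" "(i', j) \<in> D" for i i' j
    using that rook unfolding segments.rook_from_def D_def by blast
  define Q where "Q = (\<lambda>(i, j). ({i}, {j})) ` D"
  have "block_rook ns q" if "q \<in> Q" for q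
  proof -
    from that obtain i j where ij: "(i, j) \<in> D" "q = ({i}, {j})" by (auto simp: Q_def)
    then have *: "i < sum_list ns" "j < sum_list ns" "block_of ns i < block_of ns j"
      using D by (auto simp: Delta_J_iff)
    then have "i \<in> segment ns (block_of ns i)" "j \<in> segment ns (block_of ns j)"
      by (simp_all add: segment_iff)
    with * block_of_less ij(2) show ?thesis unfolding block_rook_def
      by (intro exI[of _ "block_of ns i"] exI[of _ "block_of ns j"]) auto
  qed
  moreover have "non_attacking Q" unfolding non_attacking_def Uniq_def
    using row col by (auto simp: Q_def)
  moreover have "D = (\<Union>(A, B) \<in> Q. A \<times> B)" by (auto simp: Q_def)
  ultimately have Q: "block_rooks_of ns D Q" unfolding block_rooks_of_def by blast
  with D show "block_rook_placement ns D" unfolding block_rook_placement_def by blast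
  have "det (submatrix y A B) \<noteq> 0" if "(A, B) \<in> Q" for A B
    using that by (auto simp: Q_def D_def det_submatrix_singleton yc)
  with Q y show "associated ns D y" unfolding associated_def by (auto simp: D_def)
qed

theorem proposition4p2:
  fixes ns :: "nat list" and x :: "'a::{field, finite} mat"
  assumes "x \<in> nil_algebra ns"
  shows "\<exists>D x'. block_rook_placement ns D \<and> x' \<in> nil_algebra ns \<and>
           associated ns D x' \<and> equivalent ns x x'"
proof -
  have x: "x \<in> segments.upper ns" using assms by (simp add: nil_algebra_eq)
  obtain y where y: "(segments.step ns)\<^sup>*\<^sup>* x y" "segments.rook_from ns 0 y"
    using segments.reduce_to_rook[OF x] by blast
  have "y \<in> nil_algebra ns" using segments.steps_upper[OF y(1) x] by (simp add: nil_algebra_eq)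
  moreover have "equivalent ns x y"
    by (rule conjugate_equivalent[OF segments.steps_conjugate[OF y(1) x]])
  ultimately show ?thesis using rook_associated[OF _ y(2)] by blast
qed

end
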